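(* Let $\mathcal{A}$ be a category with coequalizers and let $\mathbb{T}$ be an adjoint triangle given by adjunctions $(L,R,\eta,\epsilon)$ with $R:\mathcal{A}\to\mathcal{B}$, $(L',R',\eta',\epsilon')$ with $R':\mathcal{A}\to\mathcal{B}'$, and a functor $G:\mathcal{B}\to\mathcal{B}'$ with $GR=R'$; let $\zeta:L'G\to L$ be its associated natural transformation. Let $\mathrm{I}(\mathbb{T})$, $P(\mathbb{T}):\mathrm{I}(\mathbb{T})\to\mathcal{B}$, $\mathrm{R}(\mathbb{T}):\mathcal{A}\to \mathrm{I}(\mathbb{T})$, $\mathrm{L}(\mathbb{T}):\mathrm{I}(\mathbb{T})\to\mathcal{A}$ and $p:LP(\mathbb{T})\to \mathrm{L}(\mathbb{T})$ be as defined in the context. Then $\mathrm{L}(\mathbb{T})$ is left adjoint to $\mathrm{R}(\mathbb{T})$, where the unit $\eta(\mathbb{T}):\mathrm{Id}\to \mathrm{R}(\mathbb{T})\mathrm{L}(\mathbb{T})$ and the counit $\epsilon(\mathbb{T}):\mathrm{L}(\mathbb{T})\mathrm{R}(\mathbb{T})\to\mathrm{Id}_{\mathcal{A}}$ of the adjunction are uniquely determined by $$P(\mathbb{T})\eta(\mathbb{T})=Rp\circ \eta P(\mathbb{T}),\qquad \epsilon(\mathbb{T})\circ p\,\mathrm{R}(\mathbb{T})=\epsilon .$$ Moreover the adjunctions $(\mathrm{L}(\mathbb{T}),\mathrm{R}(\mathbb{T}))$ and $(L,R)$ together with the functor $P(\mathbb{T}):\mathrm{I}(\mathbb{T})\to\mathcal{B}$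 form an adjoint triangle (in particular $P(\mathbb{T})\mathrm{R}(\mathbb{T})=R$), whose associated natural transformation $LP(\mathbb{T})\to \mathrm{L}(\mathbb{T})$ is $p$.
   Context: Whiskering of a natural transformation $\alpha$ by functors is written $F\alpha$, $\alpha G$. Adjoint triangle: two adjunctions $(L,R,\eta,\epsilon)$, with $R:\mathcal{A}\to\mathcal{B}$ and $L$ left adjoint of $R$, and $(L',R',\eta',\epsilon')$, with $R':\mathcal{A}\to\mathcal{B}'$, and a functor $G:\mathcal{B}\to\mathcal{B}'$ such that $GR=R'$. Its associated natural transformation is $\zeta:=\epsilon'L\circ L'G\eta:L'G\to L$; it is the unique natural transformation with $\epsilon\circ\zeta R=\epsilon'$. Inserter category: for functors $F,H:\mathcal{C}\to\mathcal{D}$, the category $\langle F|H\rangle$ has as objects the pairs $(C,\alpha)$ with $C\in\mathcal{C}$ and $\alpha:FC\to HC$ any morphism of $\mathcal{D}$; a morphism $(C,\alpha)\to(C',\alpha')$ is a morphism $f:C\to C'$ with $\alpha'\circ Ff=Hf\circ\alpha$. Given an adjoint triangle $\mathbb{T}$ consisting of adjunctions $(L,R,\eta,\epsilon)$ with $R:\mathcal{A}\to\mathcal{B}$ and $(L',R',\eta',\epsilon')$ with $R':\mathcal{A}\to\mathcal{B}'$ and a functor $G:\mathcal{B}\to\mathcal{B}'$ with $GR=R'$, with associated natural transformation $\zeta:L'G\to L$, and with $\mathcal{A}$ having coequalizers (a choice of which is fixed): - $\mathrm{I}(\mathbb{T}):=\langle R'L|G\rangle$, with forgetful functor $P(\mathbb{T}):\mathrm{I}(\mathbb{T})\to\mathcal{B}$,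 $(B,b)\mapsto B$, $f\mapsto f$; - $\mathrm{R}(\mathbb{T})A:=(RA,R'\epsilon A)$, $\mathrm{R}(\mathbb{T})f:=Rf$; - for $(B,b)\in\mathrm{I}(\mathbb{T})$ (so $b:R'LB\to GB$), $p(B,b):LB\to\mathrm{L}(\mathbb{T})(B,b)$ is the coequalizer in $\mathcal{A}$ of the two morphisms $\zeta B\circ L'b$ and $\epsilon'LB$ from $L'R'LB$ to $LB$; $\mathrm{L}(\mathbb{T})$ is defined on morphisms by the universal property, making $p:LP(\mathbb{T})\to\mathrm{L}(\mathbb{T})$ natural. *)

theory Defs
  imports Main
begin

record ('o, 'm) category =
  Obj :: "'o set"
  Mor :: "'m set"
  Dom :: "'m \<Rightarrow> 'o"
  Cod :: "'m \<Rightarrow> 'o"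
  Ide :: "'o \<Rightarrow> 'm"
  Comp :: "'m \<Rightarrow> 'm \<Rightarrow> 'm" (infixr "\<cdot>\<index>" 70)

definition hom :: "('o, 'm) category \<Rightarrow> 'o \<Rightarrow> 'o \<Rightarrow> 'm set" where
  "hom C X Y = {f \<in> Mor C. Dom C f = X \<and> Cod C f = Y}"

locale category =
  fixes C :: "('o, 'm) category" (structure)
  assumes dom_closed: "f \<in> Mor C \<Longrightarrow> Dom C f \<in> Obj C"
    and cod_closed: "f \<in> Mor C \<Longrightarrow> Cod C f \<in> Obj C"
    and ide_closed: "X \<in> Obj C \<Longrightarrow> Ide C X \<in> hom C X X"
    and comp_closed: "f \<in> hom C X Y \<Longrightarrow> g \<in> hom C Y Z \<Longrightarrow> g \<cdot> f \<in> hom C X Z"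
    and comp_ide_left: "f \<in> hom C X Y \<Longrightarrow> Ide C Y \<cdot> f = f"
    and comp_ide_right: "f \<in> hom C X Y \<Longrightarrow> f \<cdot> Ide C X = f"
    and comp_assoc: "f \<in> hom C W X \<Longrightarrow> g \<in> hom C X Y \<Longrightarrow> h \<in> hom C Y Z \<Longrightarrow>
                     (h \<cdot> g) \<cdot> f = h \<cdot> (g \<cdot> f)"

text \<open>Functors and families of components are total functions of which only the values
  on the source category matter; equality is therefore taken on the source category
  (\<open>functor_eq\<close>, \<open>nat_eq\<close>).\<close>

record ('o1, 'm1, 'o2, 'm2) functor_data =
  ob :: "'o1 \<Rightarrow> 'o2"
  mor :: "'m1 \<Rightarrow> 'm2"

locale category_functor = source: category C + target: category D
  for C :: "('o1, 'm1) category" and D :: "('o2, 'm2) category" +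
  fixes F :: "('o1, 'm1, 'o2, 'm2) functor_data"
  assumes ob_closed: "X \<in> Obj C \<Longrightarrow> ob F X \<in> Obj D"
    and mor_closed: "f \<in> hom C X Y \<Longrightarrow> mor F f \<in> hom D (ob F X) (ob F Y)"
    and mor_ide: "X \<in> Obj C \<Longrightarrow> mor F (Ide C X) = Ide D (ob F X)"
    and mor_comp: "f \<in> hom C X Y \<Longrightarrow> g \<in> hom C Y Z \<Longrightarrow>
                   mor F (g \<cdot>\<^bsub>C\<^esub> f) = mor F g \<cdot>\<^bsub>D\<^esub> mor F f"

definition functor_eq ::
  "('o1, 'm1) category \<Rightarrow> ('o1, 'm1, 'o2, 'm2) functor_data \<Rightarrow>
   ('o1, 'm1, 'o2, 'm2) functor_data \<Rightarrow> bool" where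
  "functor_eq C F G \<longleftrightarrow>
     (\<forall>X \<in> Obj C. ob F X = ob G X) \<and> (\<forall>f \<in> Mor C. mor F f = mor G f)"

definition functor_id :: "('o, 'm, 'o, 'm) functor_data" where
  "functor_id = \<lparr>ob = (\<lambda>X. X), mor = (\<lambda>f. f)\<rparr>"

definition functor_comp ::
  "('o2, 'm2, 'o3, 'm3) functor_data \<Rightarrow> ('o1, 'm1, 'o2, 'm2) functor_data \<Rightarrow>
   ('o1, 'm1, 'o3, 'm3) functor_data" (infixr "\<circ>\<^sub>F" 70) where
  "G \<circ>\<^sub>F F = \<lparr>ob = (\<lambda>X. ob G (ob F X)), mor = (\<lambda>f. mor G (mor F f))\<rparr>"

definition natural_transformation ::
  "('o1, 'm1) category \<Rightarrow> ('o2, 'm2) category \<Rightarrow> ('o1, 'm1, 'o2, 'm2) functor_data \<Rightarrow>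
   ('o1, 'm1, 'o2, 'm2) functor_data \<Rightarrow> ('o1 \<Rightarrow> 'm2) \<Rightarrow> bool" where
  "natural_transformation C D F G \<alpha> \<longleftrightarrow>
     category_functor C D F \<and> category_functor C D G \<and>
     (\<forall>X \<in> Obj C. \<alpha> X \<in> hom D (ob F X) (ob G X)) \<and>
     (\<forall>f \<in> Mor C. mor G f \<cdot>\<^bsub>D\<^esub> \<alpha> (Dom C f) = \<alpha> (Cod C f) \<cdot>\<^bsub>D\<^esub> mor F f)"

definition nat_eq ::
  "('o1, 'm1) category \<Rightarrow> ('o1 \<Rightarrow> 'm2) \<Rightarrow> ('o1 \<Rightarrow> 'm2) \<Rightarrow> bool" where
  "nat_eq C \<alpha> \<beta> \<longleftrightarrow> (\<forall>X \<in> Obj C. \<alpha> X = \<beta> X)"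

definition nat_id :: "('o2, 'm2) category \<Rightarrow> ('o1, 'm1, 'o2, 'm2) functor_data \<Rightarrow> 'o1 \<Rightarrow> 'm2" where
  "nat_id D F = (\<lambda>X. Ide D (ob F X))"

definition vcomp ::
  "('o2, 'm2) category \<Rightarrow> ('o1 \<Rightarrow> 'm2) \<Rightarrow> ('o1 \<Rightarrow> 'm2) \<Rightarrow> ('o1 \<Rightarrow> 'm2)" where
  "vcomp D \<beta> \<alpha> = (\<lambda>X. \<beta> X \<cdot>\<^bsub>D\<^esub> \<alpha> X)"

text \<open>\<open>F \<rhd> \<alpha>\<close> is the whiskering $F\alpha$ and \<open>\<alpha> \<lhd> G\<close> the whiskering $\alpha G$.\<close>

definition whisker_left ::
  "('o2, 'm2, 'o3, 'm3) functor_data \<Rightarrow> ('o1 \<Rightarrow> 'm2) \<Rightarrow> ('o1 \<Rightarrow> 'm3)" (infixr "\<rhd>" 75) where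
  "F \<rhd> \<alpha> = (\<lambda>X. mor F (\<alpha> X))"

definition whisker_right ::
  "('o2 \<Rightarrow> 'm3) \<Rightarrow> ('o1, 'm1, 'o2, 'm2) functor_data \<Rightarrow> ('o1 \<Rightarrow> 'm3)" (infixl "\<lhd>" 75) where
  "\<alpha> \<lhd> G = (\<lambda>X. \<alpha> (ob G X))"

definition parallel_pair :: "('o, 'm) category \<Rightarrow> 'm \<Rightarrow> 'm \<Rightarrow> bool" where
  "parallel_pair C f g \<longleftrightarrow>
     f \<in> Mor C \<and> g \<in> Mor C \<and> Dom C f = Dom C g \<and> Cod C f = Cod C g"

definition is_coequalizer :: "('o, 'm) category \<Rightarrow> 'm \<Rightarrow> 'm \<Rightarrow> 'm \<Rightarrow> bool" where
  "is_coequalizer C f g q \<longleftrightarrow>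
     parallel_pair C f g \<and> q \<in> Mor C \<and> Dom C q = Cod C f \<and> q \<cdot>\<^bsub>C\<^esub> f = q \<cdot>\<^bsub>C\<^esub> g \<and>
     (\<forall>h \<in> Mor C. Dom C h = Cod C f \<and> h \<cdot>\<^bsub>C\<^esub> f = h \<cdot>\<^bsub>C\<^esub> g \<longrightarrow>
        (\<exists>!k. k \<in> hom C (Cod C q) (Cod C h) \<and> k \<cdot>\<^bsub>C\<^esub> q = h))"

definition coequalizer_choice :: "('o, 'm) category \<Rightarrow> ('m \<Rightarrow> 'm \<Rightarrow> 'm) \<Rightarrow> bool" where
  "coequalizer_choice C coeq \<longleftrightarrow>
     (\<forall>f g. parallel_pair C f g \<longrightarrow> is_coequalizer C f g (coeq f g))"

text \<open>An adjunction between \<open>B\<close> and \<open>A\<close> has its right adjoint going from \<open>A\<close> to \<open>B\<close>.\<close>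

record ('oa, 'ma, 'ob, 'mb) adjunction_data =
  left_adj :: "('ob, 'mb, 'oa, 'ma) functor_data"
  right_adj :: "('oa, 'ma, 'ob, 'mb) functor_data"
  unit :: "'ob \<Rightarrow> 'mb"
  counit :: "'oa \<Rightarrow> 'ma"

definition adjunction ::
  "('oa, 'ma) category \<Rightarrow> ('ob, 'mb) category \<Rightarrow> ('oa, 'ma, 'ob, 'mb) adjunction_data \<Rightarrow> bool" where
  "adjunction A B J \<longleftrightarrow>
     (let L = left_adj J; R = right_adj J; \<eta> = unit J; \<epsilon> = counit J in
      category_functor B A L \<and> category_functor A B R \<and>
      natural_transformation B B functor_id (R \<circ>\<^sub>F L) \<eta> \<and>
      natural_transformation A A (L \<circ>\<^sub>F R) functor_id \<epsilon> \<and>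
      nat_eq B (vcomp A (\<epsilon> \<lhd> L) (L \<rhd> \<eta>)) (nat_id A L) \<and>
      nat_eq A (vcomp B (R \<rhd> \<epsilon>) (\<eta> \<lhd> R)) (nat_id B R))"

record ('oa, 'ma, 'ob, 'mb, 'oc, 'mc) triangle_data =
  catA :: "('oa, 'ma) category"
  catB :: "('ob, 'mb) category"
  catB' :: "('oc, 'mc) category"
  adj :: "('oa, 'ma, 'ob, 'mb) adjunction_data"
  adj' :: "('oa, 'ma, 'oc, 'mc) adjunction_data"
  base :: "('ob, 'mb, 'oc, 'mc) functor_data"

definition adjoint_triangle ::
  "('oa, 'ma, 'ob, 'mb, 'oc, 'mc) triangle_data \<Rightarrow> bool" where
  "adjoint_triangle T \<longleftrightarrow>
     adjunction (catA T) (catB T) (adj T) \<and>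
     adjunction (catA T) (catB' T) (adj' T) \<and>
     category_functor (catB T) (catB' T) (base T) \<and>
     functor_eq (catA T) (base T \<circ>\<^sub>F right_adj (adj T)) (right_adj (adj' T))"

definition associated ::
  "('oa, 'ma, 'ob, 'mb, 'oc, 'mc) triangle_data \<Rightarrow> 'ob \<Rightarrow> 'ma" where
  "associated T =
     vcomp (catA T) (counit (adj' T) \<lhd> left_adj (adj T))
       (left_adj (adj' T) \<rhd> base T \<rhd> unit (adj T))"

text \<open>A morphism $f : (X,\alpha) \to (X',\alpha')$ is encoded as the triple
  $((X,\alpha), f, (X',\alpha'))$, so that it determines its domain and codomain.\<close>

definition inserter ::
  "('o1, 'm1) category \<Rightarrow> ('o2, 'm2) category \<Rightarrow> ('o1, 'm1, 'o2, 'm2) functor_data \<Rightarrow>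
   ('o1, 'm1, 'o2, 'm2) functor_data \<Rightarrow>
   ('o1 \<times> 'm2, ('o1 \<times> 'm2) \<times> 'm1 \<times> ('o1 \<times> 'm2)) category" where
  "inserter C D F H =
     \<lparr>Obj = {(X, \<alpha>). X \<in> Obj C \<and> \<alpha> \<in> hom D (ob F X) (ob H X)},
      Mor = {((X, \<alpha>), f, (X', \<alpha>')) | X \<alpha> f X' \<alpha>'.
               X \<in> Obj C \<and> \<alpha> \<in> hom D (ob F X) (ob H X) \<and>
               X' \<in> Obj C \<and> \<alpha>' \<in> hom D (ob F X') (ob H X') \<and>
               f \<in> hom C X X' \<and> \<alpha>' \<cdot>\<^bsub>D\<^esub> mor F f = mor H f \<cdot>\<^bsub>D\<^esub> \<alpha>},
      Dom = (\<lambda>(x, f, y). x),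
      Cod = (\<lambda>(x, f, y). y),
      Ide = (\<lambda>x. (x, Ide C (fst x), x)),
      Comp = (\<lambda>(y, g, z) (x, f, y'). (x, g \<cdot>\<^bsub>C\<^esub> f, z))\<rparr>"

definition inserter_forget ::
  "('o1 \<times> 'm2, ('o1 \<times> 'm2) \<times> 'm1 \<times> ('o1 \<times> 'm2), 'o1, 'm1) functor_data" where
  "inserter_forget = \<lparr>ob = fst, mor = (\<lambda>(x, f, y). f)\<rparr>"

definition tri_I ::
  "('oa, 'ma, 'ob, 'mb, 'oc, 'mc) triangle_data \<Rightarrow>
   ('ob \<times> 'mc, ('ob \<times> 'mc) \<times> 'mb \<times> ('ob \<times> 'mc)) category" where
  "tri_I T =
     inserter (catB T) (catB' T) (right_adj (adj' T) \<circ>\<^sub>F left_adj (adj T)) (base T)"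

definition tri_P ::
  "('oa, 'ma, 'ob, 'mb, 'oc, 'mc) triangle_data \<Rightarrow>
   ('ob \<times> 'mc, ('ob \<times> 'mc) \<times> 'mb \<times> ('ob \<times> 'mc), 'ob, 'mb) functor_data" where
  "tri_P T = inserter_forget"

definition tri_R_ob ::
  "('oa, 'ma, 'ob, 'mb, 'oc, 'mc) triangle_data \<Rightarrow> 'oa \<Rightarrow> 'ob \<times> 'mc" where
  "tri_R_ob T X = (ob (right_adj (adj T)) X, mor (right_adj (adj' T)) (counit (adj T) X))"

definition tri_R ::
  "('oa, 'ma, 'ob, 'mb, 'oc, 'mc) triangle_data \<Rightarrow>
   ('oa, 'ma, 'ob \<times> 'mc, ('ob \<times> 'mc) \<times> 'mb \<times> ('ob \<times> 'mc)) functor_data" where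
  "tri_R T =
     \<lparr>ob = tri_R_ob T,
      mor = (\<lambda>f. (tri_R_ob T (Dom (catA T) f), mor (right_adj (adj T)) f,
                  tri_R_ob T (Cod (catA T) f)))\<rparr>"

text \<open>In the following, \<open>coeq\<close> is the fixed choice of coequalizers in \<open>catA T\<close>.\<close>

definition tri_p ::
  "('oa, 'ma, 'ob, 'mb, 'oc, 'mc) triangle_data \<Rightarrow> ('ma \<Rightarrow> 'ma \<Rightarrow> 'ma) \<Rightarrow> 'ob \<times> 'mc \<Rightarrow> 'ma" where
  "tri_p T coeq = (\<lambda>(X, b).
     coeq (associated T X \<cdot>\<^bsub>catA T\<^esub> mor (left_adj (adj' T)) b)
          (counit (adj' T) (ob (left_adj (adj T)) X)))"

definition tri_L ::
  "('oa, 'ma, 'ob, 'mb, 'oc, 'mc) triangle_data \<Rightarrow> ('ma \<Rightarrow> 'ma \<Rightarrow> 'ma) \<Rightarrow>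
   ('ob \<times> 'mc, ('ob \<times> 'mc) \<times> 'mb \<times> ('ob \<times> 'mc), 'oa, 'ma) functor_data" where
  "tri_L T coeq =
     \<lparr>ob = (\<lambda>x. Cod (catA T) (tri_p T coeq x)),
      mor = (\<lambda>(x, f, y).
        THE h. h \<in> hom (catA T) (Cod (catA T) (tri_p T coeq x)) (Cod (catA T) (tri_p T coeq y)) \<and>
          h \<cdot>\<^bsub>catA T\<^esub> tri_p T coeq x =
            tri_p T coeq y \<cdot>\<^bsub>catA T\<^esub> mor (left_adj (adj T)) f)\<rparr>"

end

theory Submission
  imports Defs
begin

text \<open>
  Under the adjunction \<open>(L, R, \<eta>, \<epsilon>)\<close>, a morphism \<open>h : L X \<rightarrow> Y\<close> corresponds to its transpose
  \<open>R h \<circ> \<eta> X : X \<rightarrow> R Y\<close>. Everything rests on one observation: for an object \<open>(X, b)\<close> of the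
  inserter, the transpose of \<open>h\<close> is a morphism \<open>(X, b) \<rightarrow> (R Y, R' (\<epsilon> Y))\<close> of the inserter if and
  only if \<open>h\<close> coequalizes the pair that defines \<open>p (X, b)\<close>
  (\<open>transpose_inserter_morphism_iff\<close>). Indeed the condition on an inserter morphism reads
  \<open>R' h = R' h \<circ> G (\<eta> X) \<circ> b\<close>, because \<open>G R = R'\<close>; and transposing both sides along
  \<open>(L', R', \<eta>', \<epsilon>')\<close> turns it into \<open>h \<circ> \<epsilon>' (L X) = h \<circ> \<zeta> X \<circ> L' b\<close>.

  So inserter morphisms \<open>(X, b) \<rightarrow> R\<^sub>T Y\<close> are the same thing as morphisms out of the coequalizer
  \<open>L\<^sub>T (X, b)\<close> into \<open>Y\<close>. The observation is used in three places: for \<open>h = p x\<close>, where it makes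
  the transpose of \<open>p x\<close> a morphism of the inserter, the unit; for \<open>h = \<epsilon> Y\<close>, whose transpose is
  the identity, so that \<open>\<epsilon> Y\<close> factors through \<open>p\<close>, which is the counit; and for
  \<open>h = p y \<circ> L f\<close>, whose transpose is \<open>f\<close> followed by the unit, so that \<open>L\<^sub>T\<close> is defined on
  morphisms. All identities that remain are between morphisms out of \<open>L\<^sub>T x\<close>, and there \<open>p x\<close> can be
  cancelled since it is epic, or between morphisms of the inserter, which are determined by their
  images in the base category. Either way they reduce to identities of \<open>(L, R, \<eta>, \<epsilon>)\<close>.
\<close>

section \<open>Hom-sets, natural transformations and coequalizers\<close>

lemma (in category) hom_Obj:
  assumes "f \<in> hom C X Y"
  shows "X \<in> Obj C" "Y \<in> Obj C"
  using assms dom_closed cod_closed by (auto simp: hom_def)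

lemma Mor_in_hom: "f \<in> Mor C \<Longrightarrow> f \<in> hom C (Dom C f) (Cod C f)"
  by (simp add: hom_def)

lemma natural_transformation_component:
  assumes "natural_transformation C D F G \<alpha>" "X \<in> Obj C"
  shows "\<alpha> X \<in> hom D (ob F X) (ob G X)"
  using assms by (simp add: natural_transformation_def)

lemma naturality:
  assumes "natural_transformation C D F G \<alpha>" "f \<in> hom C X Y"
  shows "mor G f \<cdot>\<^bsub>D\<^esub> \<alpha> X = \<alpha> Y \<cdot>\<^bsub>D\<^esub> mor F f"
  using assms by (auto simp: natural_transformation_def hom_def)

lemma natural_transformationI:
  assumes "category_functor C D F" "category_functor C D G"
    and "\<And>X. X \<in> Obj C \<Longrightarrow> \<alpha> X \<in> hom D (ob F X) (ob G X)"
    and "\<And>f X Y. f \<in> hom C X Y \<Longrightarrow> mor G f \<cdot>\<^bsub>D\<^esub> \<alpha> X = \<alpha> Y \<cdot>\<^bsub>D\<^esub> mor F f"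
  shows "natural_transformation C D F G \<alpha>"
  unfolding natural_transformation_def using assms(1-3) assms(4)[OF Mor_in_hom] by blast

lemma ob_functor_comp [simp]: "ob (G \<circ>\<^sub>F F) X = ob G (ob F X)"
  and mor_functor_comp [simp]: "mor (G \<circ>\<^sub>F F) f = mor G (mor F f)"
  and ob_functor_id [simp]: "ob functor_id Y = Y"
  and mor_functor_id [simp]: "mor functor_id g = g"
  by (simp_all add: functor_comp_def functor_id_def)

lemma category_functor_id: "category C \<Longrightarrow> category_functor C C functor_id"
  by (simp add: category_functor_def category_functor_axioms_def functor_id_def)

lemma category_functor_comp:
  assumes "category_functor C D F" "category_functor D E G"
  shows "category_functor C E (G \<circ>\<^sub>F F)"
proof -
  interpret F: category_functor C D F by fact
  interpret G: category_functor D E G by fact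
  show ?thesis
  proof
    fix f g X Y Z assume f: "f \<in> hom C X Y" and g: "g \<in> hom C Y Z"
    show "mor (G \<circ>\<^sub>F F) (g \<cdot>\<^bsub>C\<^esub> f) = mor (G \<circ>\<^sub>F F) g \<cdot>\<^bsub>E\<^esub> mor (G \<circ>\<^sub>F F) f"
      by (simp add: F.mor_comp[OF f g] G.mor_comp[OF F.mor_closed[OF f] F.mor_closed[OF g]])
  qed (simp_all add: F.mor_ide G.mor_ide F.ob_closed G.ob_closed F.mor_closed G.mor_closed)
qed

lemma is_coequalizerD:
  assumes "is_coequalizer C f g q"
  shows "f \<in> hom C (Dom C f) (Cod C f)" "g \<in> hom C (Dom C f) (Cod C f)"
    "q \<in> hom C (Cod C f) (Cod C q)" "q \<cdot>\<^bsub>C\<^esub> f = q \<cdot>\<^bsub>C\<^esub> g"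
  using assms unfolding is_coequalizer_def parallel_pair_def by (simp_all add: hom_def)

lemma coequalizer_factor:
  assumes "is_coequalizer C f g q" "h \<in> hom C (Cod C f) Y" "h \<cdot>\<^bsub>C\<^esub> f = h \<cdot>\<^bsub>C\<^esub> g"
  shows "\<exists>!k. k \<in> hom C (Cod C q) Y \<and> k \<cdot>\<^bsub>C\<^esub> q = h"
proof -
  have h: "h \<in> Mor C" "Dom C h = Cod C f" "Cod C h = Y"
    using assms(2) by (simp_all add: hom_def)
  have "\<forall>h \<in> Mor C. Dom C h = Cod C f \<and> h \<cdot>\<^bsub>C\<^esub> f = h \<cdot>\<^bsub>C\<^esub> g \<longrightarrow>
      (\<exists>!k. k \<in> hom C (Cod C q) (Cod C h) \<and> k \<cdot>\<^bsub>C\<^esub> q = h)"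
    using assms(1) unfolding is_coequalizer_def by (elim conjE)
  from bspec[OF this h(1)] show ?thesis
    using h assms(3) by simp
qed

lemma (in category) coequalizer_epic:
  assumes q: "is_coequalizer C f g q" and k: "k \<in> hom C (Cod C q) Y" "k' \<in> hom C (Cod C q) Y"
    and eq: "k \<cdot> q = k' \<cdot> q"
  shows "k = k'"
proof -
  note f = is_coequalizerD(1)[OF q] and g = is_coequalizerD(2)[OF q]
    and qh = is_coequalizerD(3)[OF q] and qfg = is_coequalizerD(4)[OF q]
  have "(k \<cdot> q) \<cdot> f = (k \<cdot> q) \<cdot> g"
    by (simp add: comp_assoc[OF f qh k(1)] comp_assoc[OF g qh k(1)] qfg)
  from coequalizer_factor[OF q comp_closed[OF qh k(1)] this] show ?thesis
    using k eq by metis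
qed

section \<open>Transposition along an adjunction\<close>

locale adjoint_pair =
  fixes A :: "('oa, 'ma) category" and B :: "('ob, 'mb) category"
    and J :: "('oa, 'ma, 'ob, 'mb) adjunction_data"
  assumes adjunction: "adjunction A B J"
begin

abbreviation "L \<equiv> left_adj J"
abbreviation "R \<equiv> right_adj J"
abbreviation "\<eta> \<equiv> unit J"
abbreviation "\<epsilon> \<equiv> counit J"

lemma functor_L: "category_functor B A L" and functor_R: "category_functor A B R"
  and natural_\<eta>: "natural_transformation B B functor_id (R \<circ>\<^sub>F L) \<eta>"
  and natural_\<epsilon>: "natural_transformation A A (L \<circ>\<^sub>F R) functor_id \<epsilon>"
  using adjunction by (simp_all add: adjunction_def Let_def)

sublocale A: category A using functor_L by (simp add: category_functor_def)
sublocale B: category B using functor_L by (simp add: category_functor_def)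
sublocale L: category_functor B A L by (rule functor_L)
sublocale R: category_functor A B R by (rule functor_R)

lemma \<eta>_hom: "X \<in> Obj B \<Longrightarrow> \<eta> X \<in> hom B X (ob R (ob L X))"
  using natural_transformation_component[OF natural_\<eta>] by simp

lemma \<epsilon>_hom: "Y \<in> Obj A \<Longrightarrow> \<epsilon> Y \<in> hom A (ob L (ob R Y)) Y"
  using natural_transformation_component[OF natural_\<epsilon>] by simp

lemma \<eta>_natural: "f \<in> hom B X Y \<Longrightarrow> mor R (mor L f) \<cdot>\<^bsub>B\<^esub> \<eta> X = \<eta> Y \<cdot>\<^bsub>B\<^esub> f"
  using naturality[OF natural_\<eta>] by simp

lemma \<epsilon>_natural: "f \<in> hom A X Y \<Longrightarrow> f \<cdot>\<^bsub>A\<^esub> \<epsilon> X = \<epsilon> Y \<cdot>\<^bsub>A\<^esub> mor L (mor R f)"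
  using naturality[OF natural_\<epsilon>] by simp

lemma triangle_L: "X \<in> Obj B \<Longrightarrow> \<epsilon> (ob L X) \<cdot>\<^bsub>A\<^esub> mor L (\<eta> X) = Ide A (ob L X)"
  and triangle_R: "Y \<in> Obj A \<Longrightarrow> mor R (\<epsilon> Y) \<cdot>\<^bsub>B\<^esub> \<eta> (ob R Y) = Ide B (ob R Y)"
  using adjunction
  by (simp_all add: adjunction_def Let_def nat_eq_def vcomp_def whisker_left_def
      whisker_right_def nat_id_def)

definition transpose :: "'ob \<Rightarrow> 'ma \<Rightarrow> 'mb" where
  "transpose X h = mor R h \<cdot>\<^bsub>B\<^esub> \<eta> X"

lemma transpose_hom:
  assumes "X \<in> Obj B" "h \<in> hom A (ob L X) Y"
  shows "transpose X h \<in> hom B X (ob R Y)"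
  unfolding transpose_def
  by (rule B.comp_closed[OF \<eta>_hom[OF assms(1)] R.mor_closed[OF assms(2)]])

lemma transpose_\<epsilon>: "Y \<in> Obj A \<Longrightarrow> transpose (ob R Y) (\<epsilon> Y) = Ide B (ob R Y)"
  by (simp add: transpose_def triangle_R)

lemma counit_transpose:
  assumes X: "X \<in> Obj B" and h: "h \<in> hom A (ob L X) Y"
  shows "\<epsilon> Y \<cdot>\<^bsub>A\<^esub> mor L (transpose X h) = h"
proof -
  note Y = A.hom_Obj(2)[OF h]
  note Rh = R.mor_closed[OF h]
  have "\<epsilon> Y \<cdot>\<^bsub>A\<^esub> mor L (transpose X h) = \<epsilon> Y \<cdot>\<^bsub>A\<^esub> (mor L (mor R h) \<cdot>\<^bsub>A\<^esub> mor L (\<eta> X))"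
    unfolding transpose_def by (simp only: L.mor_comp[OF \<eta>_hom[OF X] Rh])
  also have "\<dots> = (\<epsilon> Y \<cdot>\<^bsub>A\<^esub> mor L (mor R h)) \<cdot>\<^bsub>A\<^esub> mor L (\<eta> X)"
    by (rule A.comp_assoc[symmetric, OF L.mor_closed[OF \<eta>_hom[OF X]]
          L.mor_closed[OF Rh] \<epsilon>_hom[OF Y]])
  also have "\<dots> = (h \<cdot>\<^bsub>A\<^esub> \<epsilon> (ob L X)) \<cdot>\<^bsub>A\<^esub> mor L (\<eta> X)"
    by (simp only: \<epsilon>_natural[OF h])
  also have "\<dots> = h \<cdot>\<^bsub>A\<^esub> (\<epsilon> (ob L X) \<cdot>\<^bsub>A\<^esub> mor L (\<eta> X))"
    by (rule A.comp_assoc[OF L.mor_closed[OF \<eta>_hom[OF X]]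
          \<epsilon>_hom[OF L.ob_closed[OF X]] h])
  also have "\<dots> = h"
    by (simp only: triangle_L[OF X] A.comp_ide_right[OF h])
  finally show ?thesis .
qed

lemma transpose_counit:
  assumes Y: "Y \<in> Obj A" and g: "g \<in> hom B X (ob R Y)"
  shows "transpose X (\<epsilon> Y \<cdot>\<^bsub>A\<^esub> mor L g) = g"
proof -
  note X = B.hom_Obj(1)[OF g]
  note Lg = L.mor_closed[OF g]
  have "transpose X (\<epsilon> Y \<cdot>\<^bsub>A\<^esub> mor L g) = (mor R (\<epsilon> Y) \<cdot>\<^bsub>B\<^esub> mor R (mor L g)) \<cdot>\<^bsub>B\<^esub> \<eta> X"
    unfolding transpose_def by (simp only: R.mor_comp[OF Lg \<epsilon>_hom[OF Y]])
  also have "\<dots> = mor R (\<epsilon> Y) \<cdot>\<^bsub>B\<^esub> (mor R (mor L g) \<cdot>\<^bsub>B\<^esub> \<eta> X)"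
    by (rule B.comp_assoc[OF \<eta>_hom[OF X] R.mor_closed[OF Lg] R.mor_closed[OF \<epsilon>_hom[OF Y]]])
  also have "\<dots> = mor R (\<epsilon> Y) \<cdot>\<^bsub>B\<^esub> (\<eta> (ob R Y) \<cdot>\<^bsub>B\<^esub> g)"
    by (simp only: \<eta>_natural[OF g])
  also have "\<dots> = (mor R (\<epsilon> Y) \<cdot>\<^bsub>B\<^esub> \<eta> (ob R Y)) \<cdot>\<^bsub>B\<^esub> g"
    by (rule B.comp_assoc[symmetric, OF g \<eta>_hom[OF R.ob_closed[OF Y]]
          R.mor_closed[OF \<epsilon>_hom[OF Y]]])
  also have "\<dots> = g"
    by (simp only: triangle_R[OF Y] B.comp_ide_left[OF g])
  finally show ?thesis .
qed

lemma cotranspose_eq_iff: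
  assumes "Y \<in> Obj A" "g \<in> hom B X (ob R Y)" "g' \<in> hom B X (ob R Y)"
  shows "\<epsilon> Y \<cdot>\<^bsub>A\<^esub> mor L g = \<epsilon> Y \<cdot>\<^bsub>A\<^esub> mor L g' \<longleftrightarrow> g = g'"
  using transpose_counit[OF assms(1,2)] transpose_counit[OF assms(1,3)] by metis

lemma transpose_precomp:
  assumes f: "f \<in> hom B X X'" and h: "h \<in> hom A (ob L X') Y"
  shows "transpose X (h \<cdot>\<^bsub>A\<^esub> mor L f) = transpose X' h \<cdot>\<^bsub>B\<^esub> f"
proof -
  note X = B.hom_Obj[OF f]
  note Lf = L.mor_closed[OF f]
  have "transpose X (h \<cdot>\<^bsub>A\<^esub> mor L f) = (mor R h \<cdot>\<^bsub>B\<^esub> mor R (mor L f)) \<cdot>\<^bsub>B\<^esub> \<eta> X"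
    unfolding transpose_def by (simp only: R.mor_comp[OF Lf h])
  also have "\<dots> = mor R h \<cdot>\<^bsub>B\<^esub> (\<eta> X' \<cdot>\<^bsub>B\<^esub> f)"
    by (simp only: B.comp_assoc[OF \<eta>_hom[OF X(1)] R.mor_closed[OF Lf] R.mor_closed[OF h]]
        \<eta>_natural[OF f])
  also have "\<dots> = transpose X' h \<cdot>\<^bsub>B\<^esub> f"
    unfolding transpose_def
    by (rule B.comp_assoc[symmetric, OF f \<eta>_hom[OF X(2)] R.mor_closed[OF h]])
  finally show ?thesis .
qed

lemma transpose_postcomp:
  assumes X: "X \<in> Obj B" and h: "h \<in> hom A (ob L X) Y" and k: "k \<in> hom A Y Z"
  shows "transpose X (k \<cdot>\<^bsub>A\<^esub> h) = mor R k \<cdot>\<^bsub>B\<^esub> transpose X h"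
  unfolding transpose_def R.mor_comp[OF h k]
  by (rule B.comp_assoc[OF \<eta>_hom[OF X] R.mor_closed[OF h] R.mor_closed[OF k]])

end

section \<open>The inserter category\<close>

lemma Obj_inserter:
  "x \<in> Obj (inserter C D F H) \<longleftrightarrow> fst x \<in> Obj C \<and> snd x \<in> hom D (ob F (fst x)) (ob H (fst x))"
  by (cases x) (simp add: inserter_def)

lemma hom_inserter:
  "\<phi> \<in> hom (inserter C D F H) x y \<longleftrightarrow>
     (\<exists>f. \<phi> = (x, f, y) \<and> x \<in> Obj (inserter C D F H) \<and> y \<in> Obj (inserter C D F H) \<and>
        f \<in> hom C (fst x) (fst y) \<and> snd y \<cdot>\<^bsub>D\<^esub> mor F f = mor H f \<cdot>\<^bsub>D\<^esub> snd x)"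
  by (cases x; cases y) (auto simp: inserter_def hom_def)

lemma Comp_inserter: "(y, g, z) \<cdot>\<^bsub>inserter C D F H\<^esub> (x, f, y') = (x, g \<cdot>\<^bsub>C\<^esub> f, z)"
  and Ide_inserter: "Ide (inserter C D F H) x = (x, Ide C (fst x), x)"
  by (simp_all add: inserter_def)

lemma category_inserter:
  assumes "category_functor C D F" "category_functor C D H"
  shows "category (inserter C D F H)" (is "category ?I")
proof -
  interpret F: category_functor C D F by fact
  interpret H: category_functor C D H by fact
  show ?thesis
  proof
    fix \<phi> assume "\<phi> \<in> Mor ?I"
    then show "Dom ?I \<phi> \<in> Obj ?I" "Cod ?I \<phi> \<in> Obj ?I"
      by (auto simp: inserter_def)
  next
    fix x assume x: "x \<in> Obj ?I"
    then show "Ide ?I x \<in> hom ?I x x"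
      by (auto simp: Ide_inserter hom_inserter Obj_inserter F.mor_ide H.mor_ide
          F.target.comp_ide_left F.target.comp_ide_right intro: F.source.ide_closed)
  next
    fix \<phi> \<psi> x y z assume "\<phi> \<in> hom ?I x y" "\<psi> \<in> hom ?I y z"
    then obtain f g where \<phi>: "\<phi> = (x, f, y)" and \<psi>: "\<psi> = (y, g, z)"
      and x: "x \<in> Obj ?I" and y: "y \<in> Obj ?I" and z: "z \<in> Obj ?I"
      and f: "f \<in> hom C (fst x) (fst y)" and g: "g \<in> hom C (fst y) (fst z)"
      and eqf: "snd y \<cdot>\<^bsub>D\<^esub> mor F f = mor H f \<cdot>\<^bsub>D\<^esub> snd x"
      and eqg: "snd z \<cdot>\<^bsub>D\<^esub> mor F g = mor H g \<cdot>\<^bsub>D\<^esub> snd y"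
      by (auto simp: hom_inserter)
    note sx = x[unfolded Obj_inserter, THEN conjunct2]
      and sy = y[unfolded Obj_inserter, THEN conjunct2]
      and sz = z[unfolded Obj_inserter, THEN conjunct2]
    have "snd z \<cdot>\<^bsub>D\<^esub> mor F (g \<cdot>\<^bsub>C\<^esub> f) = snd z \<cdot>\<^bsub>D\<^esub> (mor F g \<cdot>\<^bsub>D\<^esub> mor F f)"
      by (simp only: F.mor_comp[OF f g])
    also have "\<dots> = (mor H g \<cdot>\<^bsub>D\<^esub> snd y) \<cdot>\<^bsub>D\<^esub> mor F f"
      by (simp only: F.target.comp_assoc[OF F.mor_closed[OF f] F.mor_closed[OF g] sz, symmetric] eqg)
    also have "\<dots> = mor H g \<cdot>\<^bsub>D\<^esub> (mor H f \<cdot>\<^bsub>D\<^esub> snd x)"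
      by (simp only: F.target.comp_assoc[OF F.mor_closed[OF f] sy H.mor_closed[OF g]] eqf)
    also have "\<dots> = mor H (g \<cdot>\<^bsub>C\<^esub> f) \<cdot>\<^bsub>D\<^esub> snd x"
      by (simp only: F.target.comp_assoc[OF sx H.mor_closed[OF f] H.mor_closed[OF g]]
          H.mor_comp[OF f g])
    finally show "\<psi> \<cdot>\<^bsub>?I\<^esub> \<phi> \<in> hom ?I x z"
      using x z F.source.comp_closed[OF f g] by (auto simp: \<phi> \<psi> Comp_inserter hom_inserter)
  next
    fix \<phi> x y assume "\<phi> \<in> hom ?I x y"
    then show "Ide ?I y \<cdot>\<^bsub>?I\<^esub> \<phi> = \<phi>" "\<phi> \<cdot>\<^bsub>?I\<^esub> Ide ?I x = \<phi>"
      by (auto simp: hom_inserter Ide_inserter Comp_inserter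
          F.source.comp_ide_left F.source.comp_ide_right)
  next
    fix \<phi> \<psi> \<chi> w x y z
    assume "\<phi> \<in> hom ?I w x" "\<psi> \<in> hom ?I x y" "\<chi> \<in> hom ?I y z"
    then show "(\<chi> \<cdot>\<^bsub>?I\<^esub> \<psi>) \<cdot>\<^bsub>?I\<^esub> \<phi> = \<chi> \<cdot>\<^bsub>?I\<^esub> (\<psi> \<cdot>\<^bsub>?I\<^esub> \<phi>)"
      by (auto simp: hom_inserter Comp_inserter intro: F.source.comp_assoc)
  qed
qed

lemma category_functor_inserter_forget:
  assumes "category_functor C D F" "category_functor C D H"
  shows "category_functor (inserter C D F H) C inserter_forget"
proof -
  interpret F: category_functor C D F by fact
  interpret I: category "inserter C D F H" by (rule category_inserter[OF assms])
  show ?thesis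
    by unfold_locales
      (auto simp: inserter_forget_def Obj_inserter hom_inserter Ide_inserter Comp_inserter)
qed

section \<open>Inserter morphisms into the lifted right adjoint\<close>

locale triangle =
  fixes T :: "('oa, 'ma, 'ob, 'mb, 'oc, 'mc) triangle_data"
  assumes adjoint_triangle: "adjoint_triangle T"
begin

abbreviation "A \<equiv> catA T"
abbreviation "B \<equiv> catB T"
abbreviation "B' \<equiv> catB' T"
abbreviation "G \<equiv> base T"
abbreviation "\<zeta> \<equiv> associated T"
abbreviation "I\<^sub>T \<equiv> tri_I T"
abbreviation "R\<^sub>T \<equiv> tri_R T"
abbreviation "P\<^sub>T \<equiv> tri_P T"

sublocale adj: adjoint_pair A B "adj T"
  using adjoint_triangle by unfold_locales (simp add: adjoint_triangle_def)

sublocale adj': adjoint_pair A B' "adj' T"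
  using adjoint_triangle by unfold_locales (simp add: adjoint_triangle_def)

sublocale G: category_functor B B' G
  using adjoint_triangle by (simp add: adjoint_triangle_def)

abbreviation "L \<equiv> adj.L"
abbreviation "R \<equiv> adj.R"
abbreviation "\<eta> \<equiv> adj.\<eta>"
abbreviation "\<epsilon> \<equiv> adj.\<epsilon>"
abbreviation "L' \<equiv> adj'.L"
abbreviation "R' \<equiv> adj'.R"
abbreviation "\<epsilon>' \<equiv> adj'.\<epsilon>"

lemma G_R_ob: "Y \<in> Obj A \<Longrightarrow> ob G (ob R Y) = ob R' Y"
  and G_R_mor: "f \<in> hom A Y Z \<Longrightarrow> mor G (mor R f) = mor R' f"
  using adjoint_triangle by (auto simp: adjoint_triangle_def functor_eq_def hom_def)

lemma associated_component:
  "\<zeta> X = \<epsilon>' (ob L X) \<cdot>\<^bsub>A\<^esub> mor L' (mor G (\<eta> X))"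
  by (simp add: associated_def vcomp_def whisker_left_def whisker_right_def)

lemma functor_R'L: "category_functor B B' (R' \<circ>\<^sub>F L)"
  by (rule category_functor_comp[OF adj.functor_L adj'.functor_R])

lemma category_I: "category I\<^sub>T"
  unfolding tri_I_def by (rule category_inserter[OF functor_R'L G.category_functor_axioms])

sublocale I: category I\<^sub>T by (rule category_I)

lemma functor_P: "category_functor I\<^sub>T B P\<^sub>T"
  unfolding tri_I_def tri_P_def
  by (rule category_functor_inserter_forget[OF functor_R'L G.category_functor_axioms])

lemma Obj_I:
  "x \<in> Obj I\<^sub>T \<longleftrightarrow>
     fst x \<in> Obj B \<and> snd x \<in> hom B' (ob R' (ob L (fst x))) (ob G (fst x))"
  by (simp add: tri_I_def Obj_inserter)

lemma hom_I:
  "\<phi> \<in> hom I\<^sub>T x y \<longleftrightarrow>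
     (\<exists>f. \<phi> = (x, f, y) \<and> x \<in> Obj I\<^sub>T \<and> y \<in> Obj I\<^sub>T \<and> f \<in> hom B (fst x) (fst y) \<and>
        snd y \<cdot>\<^bsub>B'\<^esub> mor R' (mor L f) = mor G f \<cdot>\<^bsub>B'\<^esub> snd x)"
  by (simp add: tri_I_def hom_inserter)

lemma Comp_I: "(y, g, z) \<cdot>\<^bsub>I\<^sub>T\<^esub> (x, f, y') = (x, g \<cdot>\<^bsub>B\<^esub> f, z)"
  and Ide_I: "Ide I\<^sub>T x = (x, Ide B (fst x), x)"
  by (simp_all add: tri_I_def Comp_inserter Ide_inserter)

lemma ob_P [simp]: "ob P\<^sub>T x = fst x"
  and mor_P [simp]: "mor P\<^sub>T (x, f, y) = f"
  by (simp_all add: tri_P_def inserter_forget_def)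

lemma ob_R_T: "ob R\<^sub>T Y = (ob R Y, mor R' (\<epsilon> Y))"
  by (simp add: tri_R_def tri_R_ob_def)

lemma mor_R_T: "f \<in> hom A Y Z \<Longrightarrow> mor R\<^sub>T f = (ob R\<^sub>T Y, mor R f, ob R\<^sub>T Z)"
  by (auto simp: tri_R_def hom_def)

lemma ob_R_T_closed: "Y \<in> Obj A \<Longrightarrow> ob R\<^sub>T Y \<in> Obj I\<^sub>T"
  using adj'.R.mor_closed[OF adj.\<epsilon>_hom]
  by (simp add: ob_R_T Obj_I adj.R.ob_closed G_R_ob)

lemma functor_R_T: "category_functor A I\<^sub>T R\<^sub>T"
proof
  fix f X Y assume f: "f \<in> hom A X Y"
  note XY = adj.A.hom_Obj[OF f]
  have "mor R' (\<epsilon> Y) \<cdot>\<^bsub>B'\<^esub> mor R' (mor L (mor R f)) = mor R' f \<cdot>\<^bsub>B'\<^esub> mor R' (\<epsilon> X)"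
    by (simp only: adj'.R.mor_comp[symmetric, OF adj.L.mor_closed[OF adj.R.mor_closed[OF f]]
          adj.\<epsilon>_hom[OF XY(2)]] adj'.R.mor_comp[symmetric, OF adj.\<epsilon>_hom[OF XY(1)] f]
        adj.\<epsilon>_natural[OF f])
  then show "mor R\<^sub>T f \<in> hom I\<^sub>T (ob R\<^sub>T X) (ob R\<^sub>T Y)"
    using ob_R_T_closed[OF XY(1)] ob_R_T_closed[OF XY(2)] adj.R.mor_closed[OF f] G_R_mor[OF f]
    by (simp add: mor_R_T[OF f] hom_I ob_R_T)
  fix g Z assume g: "g \<in> hom A Y Z"
  show "mor R\<^sub>T (g \<cdot>\<^bsub>A\<^esub> f) = mor R\<^sub>T g \<cdot>\<^bsub>I\<^sub>T\<^esub> mor R\<^sub>T f"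
    by (simp add: mor_R_T[OF f] mor_R_T[OF g] mor_R_T[OF adj.A.comp_closed[OF f g]]
        Comp_I adj.R.mor_comp[OF f g])
next
  fix X assume X: "X \<in> Obj A"
  show "mor R\<^sub>T (Ide A X) = Ide I\<^sub>T (ob R\<^sub>T X)"
    by (simp add: mor_R_T[OF adj.A.ide_closed[OF X]] Ide_I adj.R.mor_ide[OF X] ob_R_T)
qed (rule ob_R_T_closed)

lemma P_R_T: "functor_eq A (P\<^sub>T \<circ>\<^sub>F R\<^sub>T) R"
  by (auto simp: functor_eq_def ob_R_T mor_R_T[OF Mor_in_hom])

lemma \<zeta>_hom:
  assumes X: "X \<in> Obj B"
  shows "\<zeta> X \<in> hom A (ob L' (ob G X)) (ob L X)"
proof -
  note LX = adj.L.ob_closed[OF X]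
  have "mor G (\<eta> X) \<in> hom B' (ob G X) (ob R' (ob L X))"
    using G.mor_closed[OF adj.\<eta>_hom[OF X]] by (simp add: G_R_ob[OF LX])
  then show ?thesis
    unfolding associated_component
    by (blast intro: adj.A.comp_closed adj'.L.mor_closed adj'.\<epsilon>_hom[OF LX])
qed

text \<open>
  Both sides of the condition on an inserter morphism are morphisms \<open>R' (L X) \<rightarrow> R' Y\<close>; their
  transposes along \<open>(L', R', \<eta>', \<epsilon>')\<close> are the two composites of \<open>h\<close> with the parallel pair, by
  naturality of \<open>\<epsilon>'\<close>.
\<close>

lemma transpose_inserter_morphism_iff:
  assumes x: "x \<in> Obj I\<^sub>T" and h: "h \<in> hom A (ob L (fst x)) Y"
  shows "(x, adj.transpose (fst x) h, ob R\<^sub>T Y) \<in> hom I\<^sub>T x (ob R\<^sub>T Y) \<longleftrightarrow>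
    h \<cdot>\<^bsub>A\<^esub> (\<zeta> (fst x) \<cdot>\<^bsub>A\<^esub> mor L' (snd x)) = h \<cdot>\<^bsub>A\<^esub> \<epsilon>' (ob L (fst x))"
proof -
  let ?X = "fst x" and ?b = "snd x"
  let ?h = "adj.transpose ?X h"
  have X: "?X \<in> Obj B" and b: "?b \<in> hom B' (ob R' (ob L ?X)) (ob G ?X)"
    using x by (auto simp: Obj_I)
  note Y = adj.A.hom_Obj(2)[OF h] and LX = adj.L.ob_closed[OF X]
  note th = adj.transpose_hom[OF X h]
  note R'h = adj'.R.mor_closed[OF h]
  have G\<eta>: "mor G (\<eta> ?X) \<in> hom B' (ob G ?X) (ob R' (ob L ?X))"
    using G.mor_closed[OF adj.\<eta>_hom[OF X]] by (simp add: G_R_ob[OF LX])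
  note G\<eta>b = adj'.B.comp_closed[OF b G\<eta>]

  have left: "mor R' (\<epsilon> Y) \<cdot>\<^bsub>B'\<^esub> mor R' (mor L ?h) = mor R' h"
    by (simp only: adj'.R.mor_comp[symmetric, OF adj.L.mor_closed[OF th] adj.\<epsilon>_hom[OF Y]]
        adj.counit_transpose[OF X h])
  have "mor G ?h = mor R' h \<cdot>\<^bsub>B'\<^esub> mor G (\<eta> ?X)"
    unfolding adj.transpose_def
    by (simp only: G.mor_comp[OF adj.\<eta>_hom[OF X] adj.R.mor_closed[OF h]] G_R_mor[OF h])
  then have right: "mor G ?h \<cdot>\<^bsub>B'\<^esub> ?b = mor R' h \<cdot>\<^bsub>B'\<^esub> (mor G (\<eta> ?X) \<cdot>\<^bsub>B'\<^esub> ?b)"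
    by (simp only: adj'.B.comp_assoc[OF b G\<eta> R'h])

  have cotranspose_left: "\<epsilon>' Y \<cdot>\<^bsub>A\<^esub> mor L' (mor R' h) = h \<cdot>\<^bsub>A\<^esub> \<epsilon>' (ob L ?X)"
    by (simp only: adj'.\<epsilon>_natural[OF h])
  have "\<epsilon>' Y \<cdot>\<^bsub>A\<^esub> mor L' (mor R' h \<cdot>\<^bsub>B'\<^esub> (mor G (\<eta> ?X) \<cdot>\<^bsub>B'\<^esub> ?b)) =
      (\<epsilon>' Y \<cdot>\<^bsub>A\<^esub> mor L' (mor R' h)) \<cdot>\<^bsub>A\<^esub> mor L' (mor G (\<eta> ?X) \<cdot>\<^bsub>B'\<^esub> ?b)"
    by (simp only: adj'.L.mor_comp[OF G\<eta>b R'h] adj.A.comp_assoc[OF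
          adj'.L.mor_closed[OF G\<eta>b] adj'.L.mor_closed[OF R'h] adj'.\<epsilon>_hom[OF Y]])
  also have "\<dots> = h \<cdot>\<^bsub>A\<^esub> (\<epsilon>' (ob L ?X) \<cdot>\<^bsub>A\<^esub> (mor L' (mor G (\<eta> ?X)) \<cdot>\<^bsub>A\<^esub> mor L' ?b))"
    by (simp only: cotranspose_left adj'.L.mor_comp[OF b G\<eta>, symmetric] adj.A.comp_assoc[OF
          adj'.L.mor_closed[OF G\<eta>b] adj'.\<epsilon>_hom[OF LX] h])
  also have "\<dots> = h \<cdot>\<^bsub>A\<^esub> (\<zeta> ?X \<cdot>\<^bsub>A\<^esub> mor L' ?b)"
    by (simp only: associated_component adj.A.comp_assoc[OF
          adj'.L.mor_closed[OF b] adj'.L.mor_closed[OF G\<eta>] adj'.\<epsilon>_hom[OF LX]])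
  finally have cotranspose_right:
    "\<epsilon>' Y \<cdot>\<^bsub>A\<^esub> mor L' (mor R' h \<cdot>\<^bsub>B'\<^esub> (mor G (\<eta> ?X) \<cdot>\<^bsub>B'\<^esub> ?b)) = h \<cdot>\<^bsub>A\<^esub> (\<zeta> ?X \<cdot>\<^bsub>A\<^esub> mor L' ?b)" .

  have "(x, ?h, ob R\<^sub>T Y) \<in> hom I\<^sub>T x (ob R\<^sub>T Y) \<longleftrightarrow>
      mor R' h = mor R' h \<cdot>\<^bsub>B'\<^esub> (mor G (\<eta> ?X) \<cdot>\<^bsub>B'\<^esub> ?b)"
    using x ob_R_T_closed[OF Y] th left right by (auto simp: hom_I ob_R_T)
  then show ?thesis
    using adj'.cotranspose_eq_iff[OF Y R'h adj'.B.comp_closed[OF G\<eta>b R'h]]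
      cotranspose_left cotranspose_right by auto
qed

end

section \<open>The lifted left adjoint\<close>

locale triangle_with_coequalizers = triangle T
  for T :: "('oa, 'ma, 'ob, 'mb, 'oc, 'mc) triangle_data" +
  fixes coeq :: "'ma \<Rightarrow> 'ma \<Rightarrow> 'ma"
  assumes coequalizer_choice: "coequalizer_choice (catA T) coeq"
begin

abbreviation "p \<equiv> tri_p T coeq"
abbreviation "L\<^sub>T \<equiv> tri_L T coeq"

lemma ob_L_T: "ob L\<^sub>T x = Cod A (p x)"
  by (simp add: tri_L_def)

lemma p_is_coequalizer:
  assumes x: "x \<in> Obj I\<^sub>T"
  shows "is_coequalizer A (\<zeta> (fst x) \<cdot>\<^bsub>A\<^esub> mor L' (snd x)) (\<epsilon>' (ob L (fst x))) (p x)"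
    and "Cod A (\<zeta> (fst x) \<cdot>\<^bsub>A\<^esub> mor L' (snd x)) = ob L (fst x)"
proof -
  have X: "fst x \<in> Obj B" and b: "snd x \<in> hom B' (ob R' (ob L (fst x))) (ob G (fst x))"
    using x by (auto simp: Obj_I)
  note adj.A.comp_closed[OF adj'.L.mor_closed[OF b] \<zeta>_hom[OF X]]
    and adj'.\<epsilon>_hom[OF adj.L.ob_closed[OF X]]
  then show "is_coequalizer A (\<zeta> (fst x) \<cdot>\<^bsub>A\<^esub> mor L' (snd x)) (\<epsilon>' (ob L (fst x))) (p x)"
    and "Cod A (\<zeta> (fst x) \<cdot>\<^bsub>A\<^esub> mor L' (snd x)) = ob L (fst x)"
    using coequalizer_choice
    by (auto simp: coequalizer_choice_def parallel_pair_def tri_p_def hom_def split: prod.split)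
qed

lemma p_hom: "x \<in> Obj I\<^sub>T \<Longrightarrow> p x \<in> hom A (ob L (fst x)) (ob L\<^sub>T x)"
  using is_coequalizerD(3)[OF p_is_coequalizer(1)[of x]] p_is_coequalizer(2)[of x]
  by (simp add: ob_L_T)

lemma ob_L_T_closed: "x \<in> Obj I\<^sub>T \<Longrightarrow> ob L\<^sub>T x \<in> Obj A"
  using adj.A.hom_Obj(2)[OF p_hom] .

lemma p_epic:
  assumes "x \<in> Obj I\<^sub>T" "k \<in> hom A (ob L\<^sub>T x) Y" "k' \<in> hom A (ob L\<^sub>T x) Y"
    and "k \<cdot>\<^bsub>A\<^esub> p x = k' \<cdot>\<^bsub>A\<^esub> p x"
  shows "k = k'"
  using adj.A.coequalizer_epic[OF p_is_coequalizer(1)[OF assms(1)]] assms(2-4)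
  by (simp add: ob_L_T)

lemma factor_through_p:
  assumes x: "x \<in> Obj I\<^sub>T" and h: "h \<in> hom A (ob L (fst x)) Y"
    and "(x, adj.transpose (fst x) h, ob R\<^sub>T Y) \<in> hom I\<^sub>T x (ob R\<^sub>T Y)"
  shows "\<exists>!k. k \<in> hom A (ob L\<^sub>T x) Y \<and> k \<cdot>\<^bsub>A\<^esub> p x = h"
  using coequalizer_factor[OF p_is_coequalizer(1)[OF x]] p_is_coequalizer(2)[OF x] h
    transpose_inserter_morphism_iff[OF x h] assms(3)
  by (simp add: ob_L_T)

definition \<eta>\<^sub>T :: "'ob \<times> 'mc \<Rightarrow> ('ob \<times> 'mc) \<times> 'mb \<times> ('ob \<times> 'mc)" where
  "\<eta>\<^sub>T x = (x, adj.transpose (fst x) (p x), ob R\<^sub>T (ob L\<^sub>T x))"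

lemma \<eta>_T_hom:
  assumes x: "x \<in> Obj I\<^sub>T"
  shows "\<eta>\<^sub>T x \<in> hom I\<^sub>T x (ob R\<^sub>T (ob L\<^sub>T x))"
  unfolding \<eta>\<^sub>T_def transpose_inserter_morphism_iff[OF x p_hom[OF x]]
  by (rule is_coequalizerD(4)[OF p_is_coequalizer(1)[OF x]])

lemma P_\<eta>_T: "mor P\<^sub>T (\<eta>\<^sub>T x) = mor R (p x) \<cdot>\<^bsub>B\<^esub> \<eta> (fst x)"
  by (simp add: \<eta>\<^sub>T_def adj.transpose_def)

text \<open>
  The transpose of \<open>p y \<circ> L f\<close> is \<open>f\<close> followed by the unit at \<open>y\<close>, a composite of morphisms of the
  inserter; hence \<open>p y \<circ> L f\<close> factors through \<open>p x\<close>.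
\<close>

lemma mor_L_T:
  assumes "\<phi> \<in> hom I\<^sub>T x y"
  shows "mor L\<^sub>T \<phi> \<in> hom A (ob L\<^sub>T x) (ob L\<^sub>T y)"
    and "mor L\<^sub>T \<phi> \<cdot>\<^bsub>A\<^esub> p x = p y \<cdot>\<^bsub>A\<^esub> mor L (mor P\<^sub>T \<phi>)"
proof -
  from assms obtain f where \<phi>: "\<phi> = (x, f, y)" and x: "x \<in> Obj I\<^sub>T" and y: "y \<in> Obj I\<^sub>T"
    and f: "f \<in> hom B (fst x) (fst y)"
    by (auto simp: hom_I)
  note h = adj.A.comp_closed[OF adj.L.mor_closed[OF f] p_hom[OF y]]
  have "\<eta>\<^sub>T y \<cdot>\<^bsub>I\<^sub>T\<^esub> \<phi> = (x, adj.transpose (fst x) (p y \<cdot>\<^bsub>A\<^esub> mor L f), ob R\<^sub>T (ob L\<^sub>T y))"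
    by (simp add: \<phi> \<eta>\<^sub>T_def Comp_I adj.transpose_precomp[OF f p_hom[OF y]])
  then have "(x, adj.transpose (fst x) (p y \<cdot>\<^bsub>A\<^esub> mor L f), ob R\<^sub>T (ob L\<^sub>T y))
      \<in> hom I\<^sub>T x (ob R\<^sub>T (ob L\<^sub>T y))"
    using I.comp_closed[OF assms \<eta>_T_hom[OF y]] by simp
  from theI'[OF factor_through_p[OF x h this]]
  show "mor L\<^sub>T \<phi> \<in> hom A (ob L\<^sub>T x) (ob L\<^sub>T y)"
    and "mor L\<^sub>T \<phi> \<cdot>\<^bsub>A\<^esub> p x = p y \<cdot>\<^bsub>A\<^esub> mor L (mor P\<^sub>T \<phi>)"
    by (simp_all add: \<phi> tri_L_def)
qed

lemma functor_L_T: "category_functor I\<^sub>T A L\<^sub>T"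
proof
  fix x assume x: "x \<in> Obj I\<^sub>T"
  then have X: "fst x \<in> Obj B" by (simp add: Obj_I)
  note i = mor_L_T[OF I.ide_closed[OF x]]
  have "mor L\<^sub>T (Ide I\<^sub>T x) \<cdot>\<^bsub>A\<^esub> p x = Ide A (ob L\<^sub>T x) \<cdot>\<^bsub>A\<^esub> p x"
    using i(2) by (simp add: Ide_I adj.L.mor_ide[OF X]
        adj.A.comp_ide_left[OF p_hom[OF x]] adj.A.comp_ide_right[OF p_hom[OF x]])
  then show "mor L\<^sub>T (Ide I\<^sub>T x) = Ide A (ob L\<^sub>T x)"
    by (rule p_epic[OF x i(1) adj.A.ide_closed[OF ob_L_T_closed[OF x]]])
next
  fix \<phi> \<psi> x y z assume \<phi>: "\<phi> \<in> hom I\<^sub>T x y" and \<psi>: "\<psi> \<in> hom I\<^sub>T y z"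
  interpret P: category_functor I\<^sub>T B P\<^sub>T by (rule functor_P)
  note x = I.hom_Obj(1)[OF \<phi>] and y = I.hom_Obj(2)[OF \<phi>] and z = I.hom_Obj(2)[OF \<psi>]
  note P\<phi> = P.mor_closed[OF \<phi>, simplified] and P\<psi> = P.mor_closed[OF \<psi>, simplified]
  note c = mor_L_T[OF I.comp_closed[OF \<phi> \<psi>]]
  have "mor L\<^sub>T (\<psi> \<cdot>\<^bsub>I\<^sub>T\<^esub> \<phi>) \<cdot>\<^bsub>A\<^esub> p x = p z \<cdot>\<^bsub>A\<^esub> (mor L (mor P\<^sub>T \<psi>) \<cdot>\<^bsub>A\<^esub> mor L (mor P\<^sub>T \<phi>))"
    by (simp only: c(2) P.mor_comp[OF \<phi> \<psi>] adj.L.mor_comp[OF P\<phi> P\<psi>])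
  also have "\<dots> = (mor L\<^sub>T \<psi> \<cdot>\<^bsub>A\<^esub> p y) \<cdot>\<^bsub>A\<^esub> mor L (mor P\<^sub>T \<phi>)"
    by (simp only: mor_L_T(2)[OF \<psi>] adj.A.comp_assoc[OF
          adj.L.mor_closed[OF P\<phi>] adj.L.mor_closed[OF P\<psi>] p_hom[OF z]])
  also have "\<dots> = mor L\<^sub>T \<psi> \<cdot>\<^bsub>A\<^esub> (mor L\<^sub>T \<phi> \<cdot>\<^bsub>A\<^esub> p x)"
    by (simp only: mor_L_T(2)[OF \<phi>] adj.A.comp_assoc[OF
          adj.L.mor_closed[OF P\<phi>] p_hom[OF y] mor_L_T(1)[OF \<psi>]])
  also have "\<dots> = (mor L\<^sub>T \<psi> \<cdot>\<^bsub>A\<^esub> mor L\<^sub>T \<phi>) \<cdot>\<^bsub>A\<^esub> p x"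
    by (rule adj.A.comp_assoc[symmetric, OF p_hom[OF x] mor_L_T(1)[OF \<phi>] mor_L_T(1)[OF \<psi>]])
  finally show "mor L\<^sub>T (\<psi> \<cdot>\<^bsub>I\<^sub>T\<^esub> \<phi>) = mor L\<^sub>T \<psi> \<cdot>\<^bsub>A\<^esub> mor L\<^sub>T \<phi>"
    by (rule p_epic[OF x c(1) adj.A.comp_closed[OF mor_L_T(1)[OF \<phi>] mor_L_T(1)[OF \<psi>]]])
qed (rule ob_L_T_closed, assumption, rule mor_L_T(1))

lemma natural_p: "natural_transformation I\<^sub>T A (L \<circ>\<^sub>F P\<^sub>T) L\<^sub>T p"
  by (rule natural_transformationI[OF category_functor_comp[OF functor_P adj.functor_L] functor_L_T])
    (simp_all add: p_hom mor_L_T(2))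

section \<open>Unit and counit of the lifted adjunction\<close>

definition \<epsilon>\<^sub>T :: "'oa \<Rightarrow> 'ma" where
  "\<epsilon>\<^sub>T Y = (THE k. k \<in> hom A (ob L\<^sub>T (ob R\<^sub>T Y)) Y \<and> k \<cdot>\<^bsub>A\<^esub> p (ob R\<^sub>T Y) = \<epsilon> Y)"

text \<open>
  The transpose of \<open>\<epsilon> Y\<close> is the identity, which underlies the identity of the inserter object
  \<open>R\<^sub>T Y\<close>; hence \<open>\<epsilon> Y\<close> factors through \<open>p\<close>.
\<close>

lemma \<epsilon>_T:
  assumes Y: "Y \<in> Obj A"
  shows "\<epsilon>\<^sub>T Y \<in> hom A (ob L\<^sub>T (ob R\<^sub>T Y)) Y" and "\<epsilon>\<^sub>T Y \<cdot>\<^bsub>A\<^esub> p (ob R\<^sub>T Y) = \<epsilon> Y"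
proof -
  note y = ob_R_T_closed[OF Y]
  have fst_y: "fst (ob R\<^sub>T Y) = ob R Y" by (simp add: ob_R_T)
  have "(ob R\<^sub>T Y, adj.transpose (fst (ob R\<^sub>T Y)) (\<epsilon> Y), ob R\<^sub>T Y) = Ide I\<^sub>T (ob R\<^sub>T Y)"
    by (simp add: fst_y adj.transpose_\<epsilon>[OF Y] Ide_I)
  then have "(ob R\<^sub>T Y, adj.transpose (fst (ob R\<^sub>T Y)) (\<epsilon> Y), ob R\<^sub>T Y)
      \<in> hom I\<^sub>T (ob R\<^sub>T Y) (ob R\<^sub>T Y)"
    using I.ide_closed[OF y] by simp
  from theI'[OF factor_through_p[OF y _ this]]
  show "\<epsilon>\<^sub>T Y \<in> hom A (ob L\<^sub>T (ob R\<^sub>T Y)) Y" and "\<epsilon>\<^sub>T Y \<cdot>\<^bsub>A\<^esub> p (ob R\<^sub>T Y) = \<epsilon> Y"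
    using adj.\<epsilon>_hom[OF Y] by (simp_all add: \<epsilon>\<^sub>T_def fst_y)
qed

lemma natural_\<eta>_T: "natural_transformation I\<^sub>T I\<^sub>T functor_id (R\<^sub>T \<circ>\<^sub>F L\<^sub>T) \<eta>\<^sub>T"
proof (rule natural_transformationI[OF category_functor_id[OF category_I]
      category_functor_comp[OF functor_L_T functor_R_T]])
  fix \<phi> x y assume \<phi>: "\<phi> \<in> hom I\<^sub>T x y"
  from \<phi> obtain f where \<phi>_eq: "\<phi> = (x, f, y)" and x: "x \<in> Obj I\<^sub>T" and y: "y \<in> Obj I\<^sub>T"
    and f: "f \<in> hom B (fst x) (fst y)" and X: "fst x \<in> Obj B"
    by (auto simp: hom_I Obj_I)
  have "mor R (mor L\<^sub>T \<phi>) \<cdot>\<^bsub>B\<^esub> adj.transpose (fst x) (p x) = adj.transpose (fst x) (mor L\<^sub>T \<phi> \<cdot>\<^bsub>A\<^esub> p x)"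
    by (rule adj.transpose_postcomp[symmetric, OF X p_hom[OF x] mor_L_T(1)[OF \<phi>]])
  also have "\<dots> = adj.transpose (fst y) (p y) \<cdot>\<^bsub>B\<^esub> f"
    unfolding mor_L_T(2)[OF \<phi>] unfolding \<phi>_eq mor_P
    by (rule adj.transpose_precomp[OF f p_hom[OF y]])
  finally show "mor (R\<^sub>T \<circ>\<^sub>F L\<^sub>T) \<phi> \<cdot>\<^bsub>I\<^sub>T\<^esub> \<eta>\<^sub>T x = \<eta>\<^sub>T y \<cdot>\<^bsub>I\<^sub>T\<^esub> mor functor_id \<phi>"
    using mor_R_T[OF mor_L_T(1)[OF \<phi>]] by (simp add: \<eta>\<^sub>T_def Comp_I \<phi>_eq)
qed (simp add: \<eta>_T_hom)

text \<open>
  Along \<open>p\<close>, passing from an inserter morphism to \<open>L\<^sub>T x \<rightarrow> Y\<close> by means of \<open>\<epsilon>\<^sub>T\<close> becomes passing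
  from the underlying morphism to \<open>L (fst x) \<rightarrow> Y\<close> by means of \<open>\<epsilon>\<close>. Since \<open>p\<close> is epic,
  naturality of \<open>\<epsilon>\<^sub>T\<close> and the first triangle identity thereby reduce to the corresponding facts
  about \<open>\<epsilon>\<close>.
\<close>

lemma \<epsilon>_T_mor_L_T:
  assumes \<phi>: "\<phi> \<in> hom I\<^sub>T x (ob R\<^sub>T Y)" and Y: "Y \<in> Obj A"
  shows "(\<epsilon>\<^sub>T Y \<cdot>\<^bsub>A\<^esub> mor L\<^sub>T \<phi>) \<cdot>\<^bsub>A\<^esub> p x = \<epsilon> Y \<cdot>\<^bsub>A\<^esub> mor L (mor P\<^sub>T \<phi>)"
proof -
  interpret P: category_functor I\<^sub>T B P\<^sub>T by (rule functor_P)
  note x = I.hom_Obj(1)[OF \<phi>] and y = ob_R_T_closed[OF Y]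
  note LP\<phi> = adj.L.mor_closed[OF P.mor_closed[OF \<phi>], simplified]
  have "(\<epsilon>\<^sub>T Y \<cdot>\<^bsub>A\<^esub> mor L\<^sub>T \<phi>) \<cdot>\<^bsub>A\<^esub> p x = \<epsilon>\<^sub>T Y \<cdot>\<^bsub>A\<^esub> (p (ob R\<^sub>T Y) \<cdot>\<^bsub>A\<^esub> mor L (mor P\<^sub>T \<phi>))"
    by (simp only: mor_L_T(2)[OF \<phi>] adj.A.comp_assoc[OF
          p_hom[OF x] mor_L_T(1)[OF \<phi>] \<epsilon>_T(1)[OF Y]])
  also have "\<dots> = \<epsilon> Y \<cdot>\<^bsub>A\<^esub> mor L (mor P\<^sub>T \<phi>)"
    by (simp only: adj.A.comp_assoc[symmetric, OF LP\<phi> p_hom[OF y] \<epsilon>_T(1)[OF Y]]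
        \<epsilon>_T(2)[OF Y])
  finally show ?thesis .
qed

lemma natural_\<epsilon>_T: "natural_transformation A A (L\<^sub>T \<circ>\<^sub>F R\<^sub>T) functor_id \<epsilon>\<^sub>T"
proof (rule natural_transformationI[OF category_functor_comp[OF functor_R_T functor_L_T]
      category_functor_id[OF adj.A.category_axioms]])
  fix f Y Z assume f: "f \<in> hom A Y Z"
  interpret R\<^sub>T: category_functor A I\<^sub>T R\<^sub>T by (rule functor_R_T)
  note YZ = adj.A.hom_Obj[OF f]
  note y = ob_R_T_closed[OF YZ(1)]
  note R\<^sub>Tf = R\<^sub>T.mor_closed[OF f]
  have "(f \<cdot>\<^bsub>A\<^esub> \<epsilon>\<^sub>T Y) \<cdot>\<^bsub>A\<^esub> p (ob R\<^sub>T Y) = f \<cdot>\<^bsub>A\<^esub> \<epsilon> Y"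
    by (simp only: \<epsilon>_T(2)[OF YZ(1)] adj.A.comp_assoc[OF p_hom[OF y] \<epsilon>_T(1)[OF YZ(1)] f])
  also have "\<dots> = (\<epsilon>\<^sub>T Z \<cdot>\<^bsub>A\<^esub> mor L\<^sub>T (mor R\<^sub>T f)) \<cdot>\<^bsub>A\<^esub> p (ob R\<^sub>T Y)"
    unfolding \<epsilon>_T_mor_L_T[OF R\<^sub>Tf YZ(2)] adj.\<epsilon>_natural[OF f] by (simp only: mor_R_T[OF f] mor_P)
  finally have "f \<cdot>\<^bsub>A\<^esub> \<epsilon>\<^sub>T Y = \<epsilon>\<^sub>T Z \<cdot>\<^bsub>A\<^esub> mor L\<^sub>T (mor R\<^sub>T f)"
    by (rule p_epic[OF y adj.A.comp_closed[OF \<epsilon>_T(1)[OF YZ(1)] f]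
          adj.A.comp_closed[OF mor_L_T(1)[OF R\<^sub>Tf] \<epsilon>_T(1)[OF YZ(2)]]])
  then show "mor functor_id f \<cdot>\<^bsub>A\<^esub> \<epsilon>\<^sub>T Y = \<epsilon>\<^sub>T Z \<cdot>\<^bsub>A\<^esub> mor (L\<^sub>T \<circ>\<^sub>F R\<^sub>T) f"
    by simp
qed (simp add: \<epsilon>_T(1))

abbreviation "adj\<^sub>T \<equiv> \<lparr>left_adj = L\<^sub>T, right_adj = R\<^sub>T, unit = \<eta>\<^sub>T, counit = \<epsilon>\<^sub>T\<rparr>"

lemma counit_transpose_p:
  assumes x: "x \<in> Obj I\<^sub>T"
  shows "\<epsilon> (ob L\<^sub>T x) \<cdot>\<^bsub>A\<^esub> mor L (mor P\<^sub>T (\<eta>\<^sub>T x)) = p x"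
  using adj.counit_transpose[OF _ p_hom[OF x]] x by (simp add: \<eta>\<^sub>T_def Obj_I)

lemma adjunction_T: "adjunction A I\<^sub>T adj\<^sub>T"
proof -
  have "\<epsilon>\<^sub>T (ob L\<^sub>T x) \<cdot>\<^bsub>A\<^esub> mor L\<^sub>T (\<eta>\<^sub>T x) = Ide A (ob L\<^sub>T x)" if x: "x \<in> Obj I\<^sub>T" for x
  proof -
    note Y = ob_L_T_closed[OF x] and \<eta>x = \<eta>_T_hom[OF x]
    have "(\<epsilon>\<^sub>T (ob L\<^sub>T x) \<cdot>\<^bsub>A\<^esub> mor L\<^sub>T (\<eta>\<^sub>T x)) \<cdot>\<^bsub>A\<^esub> p x = Ide A (ob L\<^sub>T x) \<cdot>\<^bsub>A\<^esub> p x"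
      by (simp only: \<epsilon>_T_mor_L_T[OF \<eta>x Y] counit_transpose_p[OF x]
          adj.A.comp_ide_left[OF p_hom[OF x]])
    then show ?thesis
      by (rule p_epic[OF x adj.A.comp_closed[OF mor_L_T(1)[OF \<eta>x] \<epsilon>_T(1)[OF Y]]
            adj.A.ide_closed[OF Y]])
  qed
  moreover have "mor R\<^sub>T (\<epsilon>\<^sub>T Y) \<cdot>\<^bsub>I\<^sub>T\<^esub> \<eta>\<^sub>T (ob R\<^sub>T Y) = Ide I\<^sub>T (ob R\<^sub>T Y)" if Y: "Y \<in> Obj A" for Y
  proof -
    note y = ob_R_T_closed[OF Y]
    have fst_y: "fst (ob R\<^sub>T Y) = ob R Y" by (simp add: ob_R_T)
    note p_y = p_hom[OF y, unfolded fst_y]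
    have "mor R (\<epsilon>\<^sub>T Y) \<cdot>\<^bsub>B\<^esub> adj.transpose (ob R Y) (p (ob R\<^sub>T Y)) = Ide B (ob R Y)"
      by (simp only: adj.transpose_postcomp[symmetric, OF adj.R.ob_closed[OF Y] p_y \<epsilon>_T(1)[OF Y]]
          \<epsilon>_T(2)[OF Y] adj.transpose_\<epsilon>[OF Y])
    then show ?thesis
      by (simp add: mor_R_T[OF \<epsilon>_T(1)[OF Y]] \<eta>\<^sub>T_def Comp_I Ide_I fst_y)
  qed
  ultimately show ?thesis
    using functor_L_T functor_R_T natural_\<eta>_T natural_\<epsilon>_T
    by (simp add: adjunction_def Let_def nat_eq_def vcomp_def whisker_left_def whisker_right_def
        nat_id_def)
qed

text \<open>
  The forgetful functor is faithful, and the domain and codomain of each component are prescribed.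
\<close>

lemma \<eta>_T_unique:
  assumes "natural_transformation I\<^sub>T I\<^sub>T functor_id (R\<^sub>T \<circ>\<^sub>F L\<^sub>T) \<eta>2"
    and "nat_eq I\<^sub>T (P\<^sub>T \<rhd> \<eta>2) (vcomp B (R \<rhd> p) (\<eta> \<lhd> P\<^sub>T))"
  shows "nat_eq I\<^sub>T \<eta>2 \<eta>\<^sub>T"
  unfolding nat_eq_def
proof
  fix x assume x: "x \<in> Obj I\<^sub>T"
  from natural_transformation_component[OF assms(1) x]
  obtain f where "\<eta>2 x = (x, f, ob R\<^sub>T (ob L\<^sub>T x))" by (auto simp: hom_I)
  moreover have "mor P\<^sub>T (\<eta>2 x) = adj.transpose (fst x) (p x)"
    using assms(2) x
    by (simp add: nat_eq_def vcomp_def whisker_left_def whisker_right_def adj.transpose_def)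
  ultimately show "\<eta>2 x = \<eta>\<^sub>T x"
    by (simp add: \<eta>\<^sub>T_def)
qed

lemma \<epsilon>_T_unique:
  assumes "natural_transformation A A (L\<^sub>T \<circ>\<^sub>F R\<^sub>T) functor_id \<epsilon>2"
    and "nat_eq A (vcomp A \<epsilon>2 (p \<lhd> R\<^sub>T)) \<epsilon>"
  shows "nat_eq A \<epsilon>2 \<epsilon>\<^sub>T"
  unfolding nat_eq_def
proof
  fix Y assume Y: "Y \<in> Obj A"
  have "\<epsilon>2 Y \<in> hom A (ob L\<^sub>T (ob R\<^sub>T Y)) Y"
    using natural_transformation_component[OF assms(1) Y] by simp
  moreover have "\<epsilon>2 Y \<cdot>\<^bsub>A\<^esub> p (ob R\<^sub>T Y) = \<epsilon>\<^sub>T Y \<cdot>\<^bsub>A\<^esub> p (ob R\<^sub>T Y)"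
    using assms(2) Y by (simp add: \<epsilon>_T(2) nat_eq_def vcomp_def whisker_right_def)
  ultimately show "\<epsilon>2 Y = \<epsilon>\<^sub>T Y"
    using p_epic[OF ob_R_T_closed[OF Y] _ \<epsilon>_T(1)[OF Y]] by blast
qed

abbreviation "T2 \<equiv> \<lparr>catA = A, catB = I\<^sub>T, catB' = B, adj = adj\<^sub>T, adj' = adj T, base = P\<^sub>T\<rparr>"

lemma lifted_triangle: "adjoint_triangle T2"
  using adjunction_T adj.adjunction functor_P P_R_T by (simp add: adjoint_triangle_def)

lemma associated_lifted_triangle: "nat_eq I\<^sub>T (associated T2) p"
  by (simp add: nat_eq_def associated_def vcomp_def whisker_left_def whisker_right_def
      counit_transpose_p)

end

section \<open>The lifted adjunction and its adjoint triangle\<close>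

theorem proposition2p5:
  fixes T :: "('oa, 'ma, 'ob, 'mb, 'oc, 'mc) triangle_data"
    and coeq :: "'ma \<Rightarrow> 'ma \<Rightarrow> 'ma"
  assumes "adjoint_triangle T"
    and "coequalizer_choice (catA T) coeq"
  defines "A \<equiv> catA T" and "B \<equiv> catB T"
    and "L \<equiv> left_adj (adj T)" and "R \<equiv> right_adj (adj T)"
    and "\<eta> \<equiv> unit (adj T)" and "\<epsilon> \<equiv> counit (adj T)"
    and "I\<^sub>T \<equiv> tri_I T" and "P\<^sub>T \<equiv> tri_P T" and "R\<^sub>T \<equiv> tri_R T"
    and "L\<^sub>T \<equiv> tri_L T coeq" and "p \<equiv> tri_p T coeq"
  shows "\<exists>\<eta>\<^sub>T \<epsilon>\<^sub>T.
    adjunction A I\<^sub>T \<lparr>left_adj = L\<^sub>T, right_adj = R\<^sub>T, unit = \<eta>\<^sub>T, counit = \<epsilon>\<^sub>T\<rparr> \<and>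
    nat_eq I\<^sub>T (P\<^sub>T \<rhd> \<eta>\<^sub>T) (vcomp B (R \<rhd> p) (\<eta> \<lhd> P\<^sub>T)) \<and>
    (\<forall>\<eta>2. natural_transformation I\<^sub>T I\<^sub>T functor_id (R\<^sub>T \<circ>\<^sub>F L\<^sub>T) \<eta>2 \<and>
           nat_eq I\<^sub>T (P\<^sub>T \<rhd> \<eta>2) (vcomp B (R \<rhd> p) (\<eta> \<lhd> P\<^sub>T))
           \<longrightarrow> nat_eq I\<^sub>T \<eta>2 \<eta>\<^sub>T) \<and>
    nat_eq A (vcomp A \<epsilon>\<^sub>T (p \<lhd> R\<^sub>T)) \<epsilon> \<and>
    (\<forall>\<epsilon>2. natural_transformation A A (L\<^sub>T \<circ>\<^sub>F R\<^sub>T) functor_id \<epsilon>2 \<and>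
           nat_eq A (vcomp A \<epsilon>2 (p \<lhd> R\<^sub>T)) \<epsilon>
           \<longrightarrow> nat_eq A \<epsilon>2 \<epsilon>\<^sub>T) \<and>
    functor_eq A (P\<^sub>T \<circ>\<^sub>F R\<^sub>T) R \<and>
    natural_transformation I\<^sub>T A (L \<circ>\<^sub>F P\<^sub>T) L\<^sub>T p \<and>
    (let T2 = \<lparr>catA = A, catB = I\<^sub>T, catB' = B,
               adj = \<lparr>left_adj = L\<^sub>T, right_adj = R\<^sub>T, unit = \<eta>\<^sub>T, counit = \<epsilon>\<^sub>T\<rparr>,
               adj' = adj T, base = P\<^sub>T\<rparr>
     in adjoint_triangle T2 \<and> nat_eq I\<^sub>T (associated T2) p)"
proof -
  interpret triangle_with_coequalizers T coeq
    using assms(1,2) by unfold_locales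
  have "nat_eq I\<^sub>T (P\<^sub>T \<rhd> \<eta>\<^sub>T) (vcomp B (R \<rhd> p) (\<eta> \<lhd> P\<^sub>T))"
    unfolding assms(3-)
    by (simp add: nat_eq_def vcomp_def whisker_left_def whisker_right_def P_\<eta>_T)
  moreover have "nat_eq A (vcomp A \<epsilon>\<^sub>T (p \<lhd> R\<^sub>T)) \<epsilon>"
    unfolding assms(3-)
    by (simp add: nat_eq_def vcomp_def whisker_right_def \<epsilon>_T(2))
  ultimately show ?thesis
    unfolding assms(3-) Let_def
    by (intro exI[of _ \<eta>\<^sub>T] exI[of _ \<epsilon>\<^sub>T] conjI allI impI adjunction_T P_R_T natural_p
        lifted_triangle associated_lifted_triangle)
      (simp_all add: \<eta>_T_unique \<epsilon>_T_unique)
qed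

end
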